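(* Let $A$ be a unital algebra over a noetherian commutative ring $\mathbb{K}$, let $\Delta\in A$ be well-tempered, and let $B=\widehat{A}_\Delta$. Assume that $A$ is a (left) coherent algebra. Then $B$ is (left) coherent too.
   Context: Algebras over $\mathbb{K}$ are associative and assumed to be free as $\mathbb{K}$-modules. Homotope: for $\Delta\in A$, $B^+=A_\Delta$ is the algebra with underlying module $A$ and multiplication $a\cdot_\Delta b=a\Delta b$; $B=\widehat{A}_\Delta=\mathbb{K}\cdot 1\oplus B^+$ is obtained by adjoining a unit, so $B^+$ is a two-sided ideal of $B$. $\Delta$ is well-tempered if the multiplication map $B^+\otimes_{\mathbb{K}}B^+\to B^+$ is surjective (equivalently $A\Delta A=A$) and $B^+$ is projective both as a left and as a right $B$-module. A left module $M$ over a ring is coherent if it is finitely generated and for every morphism $\varphi:P\to M$ with $P$ free of finite rank the kernel of $\varphi$ is finitely generated. A ring is (left) coherent if it is coherent as a left module over itself. *)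

theory Defs
  imports "HOL-Algebra.Module" "HOL-Algebra.Ring_Divisibility" "HOL-Algebra.Ideal_Product"
begin

section \<open>Left modules over not necessarily commutative rings\<close>

text \<open>The axioms are those of \<^locale>\<open>module\<close>, whose scalars have to be commutative.\<close>

locale left_module = R?: ring R + M?: abelian_group M
  for R :: "('r, 's) ring_scheme" (structure) and M :: "('r, 'm, 't) module_scheme" (structure) +
  assumes smult_closed:
      "\<lbrakk>a \<in> carrier R; x \<in> carrier M\<rbrakk> \<Longrightarrow> a \<odot>\<^bsub>M\<^esub> x \<in> carrier M"
    and smult_l_distr:
      "\<lbrakk>a \<in> carrier R; b \<in> carrier R; x \<in> carrier M\<rbrakk> \<Longrightarrow>
        (a \<oplus> b) \<odot>\<^bsub>M\<^esub> x = a \<odot>\<^bsub>M\<^esub> x \<oplus>\<^bsub>M\<^esub> b \<odot>\<^bsub>M\<^esub> x"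
    and smult_r_distr:
      "\<lbrakk>a \<in> carrier R; x \<in> carrier M; y \<in> carrier M\<rbrakk> \<Longrightarrow>
        a \<odot>\<^bsub>M\<^esub> (x \<oplus>\<^bsub>M\<^esub> y) = a \<odot>\<^bsub>M\<^esub> x \<oplus>\<^bsub>M\<^esub> a \<odot>\<^bsub>M\<^esub> y"
    and smult_assoc1:
      "\<lbrakk>a \<in> carrier R; b \<in> carrier R; x \<in> carrier M\<rbrakk> \<Longrightarrow>
        (a \<otimes> b) \<odot>\<^bsub>M\<^esub> x = a \<odot>\<^bsub>M\<^esub> (b \<odot>\<^bsub>M\<^esub> x)"
    and smult_one:
      "x \<in> carrier M \<Longrightarrow> \<one> \<odot>\<^bsub>M\<^esub> x = x"

definition left_module_hom ::
  "('r, 's) ring_scheme \<Rightarrow> ('r, 'm, 't) module_scheme \<Rightarrow> ('r, 'n, 'u) module_scheme \<Rightarrow> ('m \<Rightarrow> 'n) set"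
  where "left_module_hom R M N =
    {f \<in> carrier M \<rightarrow> carrier N.
      (\<forall>x \<in> carrier M. \<forall>y \<in> carrier M. f (x \<oplus>\<^bsub>M\<^esub> y) = f x \<oplus>\<^bsub>N\<^esub> f y) \<and>
      (\<forall>a \<in> carrier R. \<forall>x \<in> carrier M. f (a \<odot>\<^bsub>M\<^esub> x) = a \<odot>\<^bsub>N\<^esub> f x)}"

text \<open>The \<open>mult\<close> and \<open>one\<close> fields that modules inherit from the record type
  \<^typ>\<open>('r, 'm) module\<close> carry no meaning; they are left undefined below.\<close>

text \<open>The module of finitely supported families indexed by \<open>I\<close>, extended by zero outside \<open>I\<close>;
  for \<open>I = {..<n}\<close> it is the free module of rank \<open>n\<close>.\<close>

definition free_mod :: "('r, 's) ring_scheme \<Rightarrow> 'i set \<Rightarrow> ('r, 'i \<Rightarrow> 'r) module"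
  where "free_mod R I =
    \<lparr>carrier = {c. (\<forall>i \<in> I. c i \<in> carrier R) \<and> (\<forall>i. i \<notin> I \<longrightarrow> c i = \<zero>\<^bsub>R\<^esub>) \<and> finite {i. c i \<noteq> \<zero>\<^bsub>R\<^esub>}},
     monoid.mult = undefined, monoid.one = undefined,
     ring.zero = (\<lambda>i. \<zero>\<^bsub>R\<^esub>),
     ring.add = (\<lambda>c d i. c i \<oplus>\<^bsub>R\<^esub> d i),
     module.smult = (\<lambda>a c i. a \<otimes>\<^bsub>R\<^esub> c i)\<rparr>"

definition lin_comb :: "('r, 's) ring_scheme \<Rightarrow> ('r, 'm, 't) module_scheme \<Rightarrow> ('m \<Rightarrow> 'r) \<Rightarrow> 'm"
  where "lin_comb R M c = (\<Oplus>\<^bsub>M\<^esub>x \<in> {x. c x \<noteq> \<zero>\<^bsub>R\<^esub>}. c x \<odot>\<^bsub>M\<^esub> x)"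

definition fin_gen_module :: "('r, 's) ring_scheme \<Rightarrow> ('r, 'm, 't) module_scheme \<Rightarrow> bool"
  where "fin_gen_module R M \<longleftrightarrow> left_module R M \<and>
    (\<exists>X \<subseteq> carrier M. finite X \<and> lin_comb R M ` carrier (free_mod R X) = carrier M)"

definition free_module :: "('r, 's) ring_scheme \<Rightarrow> ('r, 'm, 't) module_scheme \<Rightarrow> bool"
  where "free_module R M \<longleftrightarrow> left_module R M \<and>
    (\<exists>X \<subseteq> carrier M. bij_betw (lin_comb R M) (carrier (free_mod R X)) (carrier M))"

text \<open>Projective means: direct summand of a free module. Index sets in the type of \<open>M\<close> suffice,
  since a projective \<open>M\<close> is a retract of the free module on the set \<open>carrier M\<close>.\<close>

definition projective_module :: "('r, 's) ring_scheme \<Rightarrow> ('r, 'm, 't) module_scheme \<Rightarrow> bool"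
  where "projective_module R M \<longleftrightarrow> left_module R M \<and>
    (\<exists>(I :: 'm set). \<exists>\<iota> \<in> left_module_hom R M (free_mod R I). \<exists>\<pi> \<in> left_module_hom R (free_mod R I) M.
      \<forall>x \<in> carrier M. \<pi> (\<iota> x) = x)"

definition coherent_module :: "('r, 's) ring_scheme \<Rightarrow> ('r, 'm, 't) module_scheme \<Rightarrow> bool"
  where "coherent_module R M \<longleftrightarrow> fin_gen_module R M \<and>
    (\<forall>n :: nat. \<forall>\<phi> \<in> left_module_hom R (free_mod R {..<n}) M.
      fin_gen_module R ((free_mod R {..<n})
        \<lparr>carrier := {p \<in> carrier (free_mod R {..<n}). \<phi> p = \<zero>\<^bsub>M\<^esub>}\<rparr>))"

definition left_ideal_module :: "('r, 's) ring_scheme \<Rightarrow> 'r set \<Rightarrow> ('r, 'r) module"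
  where "left_ideal_module R I =
    \<lparr>carrier = I, monoid.mult = undefined, monoid.one = undefined,
     ring.zero = \<zero>\<^bsub>R\<^esub>, ring.add = (\<oplus>\<^bsub>R\<^esub>), module.smult = (\<otimes>\<^bsub>R\<^esub>)\<rparr>"

definition left_coherent_ring :: "('r, 's) ring_scheme \<Rightarrow> bool"
  where "left_coherent_ring R \<longleftrightarrow> coherent_module R (left_ideal_module R (carrier R))"

text \<open>Right \<open>R\<close>-modules are left modules over the opposite ring.\<close>

definition opposite_ring :: "('r, 's) ring_scheme \<Rightarrow> ('r, 's) ring_scheme"
  where "opposite_ring R = R\<lparr>monoid.mult := (\<lambda>x y. y \<otimes>\<^bsub>R\<^esub> x)\<rparr>"


section \<open>Unital algebras and homotopes\<close>

text \<open>The library's locale \<^locale>\<open>algebra\<close> is restricted to commutative algebras.\<close>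

locale unital_algebra = module K A + A?: ring A for K (structure) and A (structure) +
  assumes smult_mult_left:
      "\<lbrakk>k \<in> carrier K; x \<in> carrier A; y \<in> carrier A\<rbrakk> \<Longrightarrow>
        (k \<odot>\<^bsub>A\<^esub> x) \<otimes>\<^bsub>A\<^esub> y = k \<odot>\<^bsub>A\<^esub> (x \<otimes>\<^bsub>A\<^esub> y)"
    and smult_mult_right:
      "\<lbrakk>k \<in> carrier K; x \<in> carrier A; y \<in> carrier A\<rbrakk> \<Longrightarrow>
        x \<otimes>\<^bsub>A\<^esub> (k \<odot>\<^bsub>A\<^esub> y) = k \<odot>\<^bsub>A\<^esub> (x \<otimes>\<^bsub>A\<^esub> y)"

text \<open>The homotope need not have a unit, whence the undefined field.\<close>

definition homotope :: "('k, 'a) module \<Rightarrow> 'a \<Rightarrow> ('k, 'a) module"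
  where "homotope A \<Delta> = A\<lparr>monoid.mult := (\<lambda>x y. x \<otimes>\<^bsub>A\<^esub> \<Delta> \<otimes>\<^bsub>A\<^esub> y), monoid.one := undefined\<rparr>"

definition unitization :: "('k, 's) ring_scheme \<Rightarrow> ('k, 'a) module \<Rightarrow> ('k \<times> 'a) ring"
  where "unitization K C =
    \<lparr>carrier = carrier K \<times> carrier C,
     monoid.mult = (\<lambda>(k, x) (l, y). (k \<otimes>\<^bsub>K\<^esub> l, (k \<odot>\<^bsub>C\<^esub> y \<oplus>\<^bsub>C\<^esub> l \<odot>\<^bsub>C\<^esub> x) \<oplus>\<^bsub>C\<^esub> x \<otimes>\<^bsub>C\<^esub> y)),
     monoid.one = (\<one>\<^bsub>K\<^esub>, \<zero>\<^bsub>C\<^esub>),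
     ring.zero = (\<zero>\<^bsub>K\<^esub>, \<zero>\<^bsub>C\<^esub>),
     ring.add = (\<lambda>(k, x) (l, y). (k \<oplus>\<^bsub>K\<^esub> l, x \<oplus>\<^bsub>C\<^esub> y))\<rparr>"

definition unital_homotope :: "('k, 's) ring_scheme \<Rightarrow> ('k, 'a) module \<Rightarrow> 'a \<Rightarrow> ('k \<times> 'a) ring"
  where "unital_homotope K A \<Delta> = unitization K (homotope A \<Delta>)"

definition augmentation_ideal :: "('k, 's) ring_scheme \<Rightarrow> ('k, 'a) module \<Rightarrow> ('k \<times> 'a) set"
  where "augmentation_ideal K A = {\<zero>\<^bsub>K\<^esub>} \<times> carrier A"

text \<open>The image of the multiplication map \<open>B\<^sup>+ \<otimes> B\<^sup>+ \<rightarrow> B\<^sup>+\<close> consists of the finite sums of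
  products of two elements of \<open>B\<^sup>+\<close>, i.e. it is \<^const>\<open>ideal_prod\<close> taken in the homotope; its
  surjectivity is the condition \<open>A \<Delta> A = A\<close>.\<close>

definition well_tempered :: "('k, 's) ring_scheme \<Rightarrow> ('k, 'a) module \<Rightarrow> 'a \<Rightarrow> bool"
  where "well_tempered K A \<Delta> \<longleftrightarrow>
    carrier A \<cdot>\<^bsub>homotope A \<Delta>\<^esub> carrier A = carrier A \<and>
    projective_module (unital_homotope K A \<Delta>)
      (left_ideal_module (unital_homotope K A \<Delta>) (augmentation_ideal K A)) \<and>
    projective_module (opposite_ring (unital_homotope K A \<Delta>))
      (left_ideal_module (opposite_ring (unital_homotope K A \<Delta>)) (augmentation_ideal K A))"

end

theory Submission
  imports Defs
begin

text \<open>Let \<open>N\<close> be the kernel of a \<open>B\<close>-linear map \<open>\<phi> : B\<^sup>n \<rightarrow> B\<close>, and let \<open>L\<close> be its intersection with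
  \<open>(B\<^sup>+)\<^sup>n = A\<^sup>n\<close>. Write \<open>1 = \<Sum> x\<^sub>i \<Delta> y\<^sub>i\<close>, which is possible since \<open>A \<Delta> A = A\<close>. Then
  \<open>a x = \<Sum> (a x\<^sub>i) \<cdot>\<^sub>\<Delta> (y\<^sub>i x)\<close> for \<open>x\<close> in \<open>A\<^sup>n\<close>; hence \<open>\<phi>\<close> restricts to an \<open>A\<close>-linear map
  \<open>A\<^sup>n \<rightarrow> A\<close>, whose kernel \<open>L\<close> is finitely generated over \<open>A\<close> by coherence, and if \<open>l\<^sub>1, \<dots>, l\<^sub>m\<close>
  generate \<open>L\<close> over \<open>A\<close>, then the \<open>y\<^sub>i l\<^sub>j\<close> generate it over \<open>B\<close>. Finally \<open>N / L\<close> embeds into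
  \<open>(B / B\<^sup>+)\<^sup>n = K\<^sup>n\<close>, so it is finitely generated because \<open>K\<close> is noetherian.\<close>

section \<open>Finitely generated submodules\<close>

text \<open>Negatives need no clause of their own: \<open>- x\<close> is the multiple of
  \<open>x\<close> by the scalar \<open>-1\<close>.\<close>

definition left_submodule ::
  "('r, 's) ring_scheme \<Rightarrow> ('r, 'm, 't) module_scheme \<Rightarrow> 'm set \<Rightarrow> bool"
  where "left_submodule R M S \<longleftrightarrow> S \<subseteq> carrier M \<and> \<zero>\<^bsub>M\<^esub> \<in> S \<and>
    (\<forall>x \<in> S. \<forall>y \<in> S. x \<oplus>\<^bsub>M\<^esub> y \<in> S) \<and> (\<forall>a \<in> carrier R. \<forall>x \<in> S. a \<odot>\<^bsub>M\<^esub> x \<in> S)"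

text \<open>Generation is encoded by minimality instead of linear combinations, so that finite
  generation is proved and used by exhibiting suitable submodules \<open>T\<close> of the ambient
  module.\<close>

definition fin_gen_submodule ::
  "('r, 's) ring_scheme \<Rightarrow> ('r, 'm, 't) module_scheme \<Rightarrow> 'm set \<Rightarrow> bool"
  where "fin_gen_submodule R M S \<longleftrightarrow>
    (\<exists>X \<subseteq> S. finite X \<and> (\<forall>T. left_submodule R M T \<longrightarrow> X \<subseteq> T \<longrightarrow> S \<subseteq> T))"

lemma left_submoduleI:
  assumes "S \<subseteq> carrier M" and "\<zero>\<^bsub>M\<^esub> \<in> S"
    and "\<And>x y. x \<in> S \<Longrightarrow> y \<in> S \<Longrightarrow> x \<oplus>\<^bsub>M\<^esub> y \<in> S"
    and "\<And>a x. a \<in> carrier R \<Longrightarrow> x \<in> S \<Longrightarrow> a \<odot>\<^bsub>M\<^esub> x \<in> S"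
  shows "left_submodule R M S"
  using assms unfolding left_submodule_def by blast

lemma left_submoduleD:
  assumes "left_submodule R M S"
  shows left_submodule_subset: "S \<subseteq> carrier M"
    and left_submodule_carrier: "x \<in> S \<Longrightarrow> x \<in> carrier M"
    and left_submodule_zero: "\<zero>\<^bsub>M\<^esub> \<in> S"
    and left_submodule_add: "x \<in> S \<Longrightarrow> y \<in> S \<Longrightarrow> x \<oplus>\<^bsub>M\<^esub> y \<in> S"
    and left_submodule_smult: "a \<in> carrier R \<Longrightarrow> x \<in> S \<Longrightarrow> a \<odot>\<^bsub>M\<^esub> x \<in> S"
  using assms unfolding left_submodule_def by auto

section \<open>Submodules and linear combinations in a fixed left module\<close>

context left_module
begin

lemma smult_l_null: "x \<in> carrier M \<Longrightarrow> \<zero> \<odot>\<^bsub>M\<^esub> x = \<zero>\<^bsub>M\<^esub>"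
  by (metis M.add.r_cancel_one' R.l_zero R.zero_closed smult_closed smult_l_distr)

lemma smult_r_null: "a \<in> carrier R \<Longrightarrow> a \<odot>\<^bsub>M\<^esub> \<zero>\<^bsub>M\<^esub> = \<zero>\<^bsub>M\<^esub>"
  by (metis M.add.r_cancel_one' M.l_zero M.zero_closed smult_closed smult_r_distr)

lemma smult_minus_one: "x \<in> carrier M \<Longrightarrow> (\<ominus> \<one>) \<odot>\<^bsub>M\<^esub> x = \<ominus>\<^bsub>M\<^esub> x"
  by (metis M.minus_equality R.add.inv_closed R.l_neg R.one_closed smult_closed smult_l_distr
      smult_l_null smult_one)

lemma left_module_submodule:
  assumes S: "left_submodule R M S"
  shows "left_module R (M\<lparr>carrier := S\<rparr>)"
proof -
  note S' = left_submoduleD[OF S]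
  have "\<exists>y \<in> S. y \<oplus>\<^bsub>M\<^esub> x = \<zero>\<^bsub>M\<^esub>" if "x \<in> S" for x
    using that S' smult_minus_one M.l_neg by (metis R.add.inv_closed R.one_closed)
  then have "abelian_group (M\<lparr>carrier := S\<rparr>)"
    by (intro abelian_groupI) (simp_all add: S' M.a_ac)
  then show ?thesis
    by (intro left_module.intro left_module_axioms.intro R.ring_axioms)
      (simp_all add: S' smult_l_distr smult_r_distr smult_assoc1 smult_one)
qed

lemma smult_finsum:
  assumes "finite X" "f \<in> X \<rightarrow> carrier M" "a \<in> carrier R"
  shows "a \<odot>\<^bsub>M\<^esub> (\<Oplus>\<^bsub>M\<^esub>x\<in>X. f x) = (\<Oplus>\<^bsub>M\<^esub>x\<in>X. a \<odot>\<^bsub>M\<^esub> f x)"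
  using assms
proof (induction X rule: finite_induct)
  case (insert x X)
  then have "a \<odot>\<^bsub>M\<^esub> finsum M f (insert x X) = a \<odot>\<^bsub>M\<^esub> f x \<oplus>\<^bsub>M\<^esub> a \<odot>\<^bsub>M\<^esub> finsum M f X"
    by (simp add: smult_r_distr Pi_def)
  then show ?case
    using insert by (simp add: smult_closed Pi_def)
qed (simp add: smult_r_null)

text \<open>The support over which \<open>lin_comb\<close> sums varies with \<open>c\<close>. Zero
  coefficients contribute nothing, so the sum may run over the fixed set \<open>X\<close>, where
  combinations are added and scaled term by term.\<close>

lemma lin_comb_eq_finsum:
  assumes "finite X" "X \<subseteq> carrier M" "c \<in> carrier (free_mod R X)"
  shows "lin_comb R M c = (\<Oplus>\<^bsub>M\<^esub>x\<in>X. c x \<odot>\<^bsub>M\<^esub> x)"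
  unfolding lin_comb_def using assms
  by (intro M.add.finprod_mono_neutral_cong_left)
    (auto simp: free_mod_def smult_l_null subset_iff intro!: smult_closed)

lemma left_submodule_lin_comb:
  assumes X: "finite X" "X \<subseteq> carrier M"
  shows "left_submodule R M (lin_comb R M ` carrier (free_mod R X))"
proof -
  let ?F = "free_mod R X"
  have cl: "(\<lambda>x. c x \<odot>\<^bsub>M\<^esub> x) \<in> X \<rightarrow> carrier M" if "c \<in> carrier ?F" for c
    using that X by (auto simp: free_mod_def intro!: smult_closed)
  have fin: "finite {x. f x \<noteq> \<zero>}" if "\<And>x. x \<notin> X \<Longrightarrow> f x = \<zero>" for f
    using that by (auto intro!: finite_subset[OF _ X(1)])
  show ?thesis
  proof (rule left_submoduleI)
    show "lin_comb R M ` carrier ?F \<subseteq> carrier M"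
      using X by (auto simp: lin_comb_eq_finsum intro!: M.finsum_closed cl)
  next
    have "(\<lambda>_. \<zero>) \<in> carrier ?F"
      by (simp add: free_mod_def)
    moreover have "lin_comb R M (\<lambda>_. \<zero>) = \<zero>\<^bsub>M\<^esub>"
      by (simp add: lin_comb_def)
    ultimately show "\<zero>\<^bsub>M\<^esub> \<in> lin_comb R M ` carrier ?F"
      by (metis imageI)
  next
    fix u v assume "u \<in> lin_comb R M ` carrier ?F" "v \<in> lin_comb R M ` carrier ?F"
    then obtain c d where c: "c \<in> carrier ?F" "u = lin_comb R M c"
      and d: "d \<in> carrier ?F" "v = lin_comb R M d" by auto
    let ?e = "\<lambda>x. c x \<oplus> d x"
    have e: "?e \<in> carrier ?F"
      using c(1) d(1) fin[of ?e] by (auto simp: free_mod_def)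
    have "u \<oplus>\<^bsub>M\<^esub> v = (\<Oplus>\<^bsub>M\<^esub>x\<in>X. c x \<odot>\<^bsub>M\<^esub> x \<oplus>\<^bsub>M\<^esub> d x \<odot>\<^bsub>M\<^esub> x)"
      using X c d by (simp add: lin_comb_eq_finsum cl M.finsum_addf)
    also have "\<dots> = lin_comb R M ?e"
      unfolding lin_comb_eq_finsum[OF X e] using X c(1) d(1)
      by (intro M.finsum_cong')
        (auto simp: smult_l_distr free_mod_def subset_iff intro!: smult_closed)
    finally show "u \<oplus>\<^bsub>M\<^esub> v \<in> lin_comb R M ` carrier ?F"
      using e by simp
  next
    fix a u assume a: "a \<in> carrier R" and "u \<in> lin_comb R M ` carrier ?F"
    then obtain c where c: "c \<in> carrier ?F" "u = lin_comb R M c" by auto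
    let ?e = "\<lambda>x. a \<otimes> c x"
    have e: "?e \<in> carrier ?F"
      using c(1) a fin[of ?e] by (auto simp: free_mod_def)
    have "a \<odot>\<^bsub>M\<^esub> u = (\<Oplus>\<^bsub>M\<^esub>x\<in>X. a \<odot>\<^bsub>M\<^esub> (c x \<odot>\<^bsub>M\<^esub> x))"
      using X c a by (simp add: lin_comb_eq_finsum cl smult_finsum)
    also have "\<dots> = lin_comb R M ?e"
      unfolding lin_comb_eq_finsum[OF X e] using X c(1) a
      by (intro M.finsum_cong')
        (auto simp: smult_assoc1 free_mod_def subset_iff intro!: smult_closed)
    finally show "a \<odot>\<^bsub>M\<^esub> u \<in> lin_comb R M ` carrier ?F"
      using e by simp
  qed
qed

lemma subset_lin_comb:
  assumes X: "finite X" "X \<subseteq> carrier M"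
  shows "X \<subseteq> lin_comb R M ` carrier (free_mod R X)"
proof
  fix y assume y: "y \<in> X"
  let ?c = "\<lambda>x. if x = y then \<one> else \<zero>"
  have c: "?c \<in> carrier (free_mod R X)"
    using y by (auto simp: free_mod_def intro: finite_subset[of _ "{y}"])
  have "lin_comb R M ?c = (\<Oplus>\<^bsub>M\<^esub>x\<in>X. if y = x then x else \<zero>\<^bsub>M\<^esub>)"
    unfolding lin_comb_eq_finsum[OF X c] using X y
    by (intro M.finsum_cong') (auto simp: smult_one smult_l_null)
  also have "\<dots> = y"
    using X y by (intro M.finsum_singleton) auto
  finally show "y \<in> lin_comb R M ` carrier (free_mod R X)"
    using c by (metis imageI)
qed

lemma lin_comb_in_submodule:
  assumes T: "left_submodule R M T" "X \<subseteq> T" and X: "finite X"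
    and c: "c \<in> carrier (free_mod R X)"
  shows "lin_comb R M c \<in> T"
proof -
  note T' = left_submoduleD[OF T(1)]
  have XM: "X \<subseteq> carrier M"
    using T T' by blast
  have "(\<Oplus>\<^bsub>M\<^esub>x\<in>Y. c x \<odot>\<^bsub>M\<^esub> x) \<in> T" if "finite Y" "Y \<subseteq> X" for Y
    using that
  proof (induction Y rule: finite_induct)
    case (insert y Y)
    have "c x \<odot>\<^bsub>M\<^esub> x \<in> T" if "x \<in> insert y Y" for x
      using insert that c T T' by (auto simp: free_mod_def subset_iff)
    with insert show ?case
      using T' by (subst M.finsum_insert) auto
  qed (use T' in simp)
  then show ?thesis
    using lin_comb_eq_finsum[OF X XM c] X by simp
qed

text \<open>The linear combinations of \<open>X\<close> form a submodule, contain \<open>X\<close>,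
  and lie in every submodule containing \<open>X\<close>. They are thus the smallest such submodule,
  and it is all of \<open>M\<close> exactly when every submodule containing \<open>X\<close>
  is.\<close>

lemma fin_gen_module_iff: "fin_gen_module R M \<longleftrightarrow> fin_gen_submodule R M (carrier M)"
proof -
  have "(lin_comb R M ` carrier (free_mod R X) = carrier M) =
      (\<forall>T. left_submodule R M T \<longrightarrow> X \<subseteq> T \<longrightarrow> carrier M \<subseteq> T)" (is "?L = ?R")
    if X: "X \<subseteq> carrier M" "finite X" for X
  proof
    assume L: ?L
    show ?R
    proof (intro allI impI)
      fix T assume "left_submodule R M T" "X \<subseteq> T"
      then have "lin_comb R M ` carrier (free_mod R X) \<subseteq> T"
        using lin_comb_in_submodule[OF _ _ X(2)] by (intro image_subsetI)
      then show "carrier M \<subseteq> T"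
        using L by (simp only:)
    qed
  next
    assume ?R
    then have "carrier M \<subseteq> lin_comb R M ` carrier (free_mod R X)"
      using left_submodule_lin_comb[OF X(2,1)] subset_lin_comb[OF X(2,1)] by blast
    then show ?L
      using left_submodule_subset[OF left_submodule_lin_comb[OF X(2,1)]] by blast
  qed
  then have "(\<exists>X \<subseteq> carrier M. finite X \<and> lin_comb R M ` carrier (free_mod R X) = carrier M) =
      (\<exists>X \<subseteq> carrier M. finite X \<and>
        (\<forall>T. left_submodule R M T \<longrightarrow> X \<subseteq> T \<longrightarrow> carrier M \<subseteq> T))"
    by (intro ex_cong1 conj_cong refl)
  then show ?thesis
    unfolding fin_gen_module_def fin_gen_submodule_def
    using left_module_axioms by (simp only: simp_thms)
qed

text \<open>The submodules of \<open>S\<close> are the submodules of \<open>M\<close> inside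
  \<open>S\<close>. An arbitrary submodule \<open>T\<close> of \<open>M\<close> is tested through
  \<open>T \<inter> S\<close>, so both ranges of \<open>T\<close> give the same notion of
  generation.\<close>

lemma fin_gen_module_submodule_iff:
  assumes S: "left_submodule R M S"
  shows "fin_gen_module R (M\<lparr>carrier := S\<rparr>) \<longleftrightarrow> fin_gen_submodule R M S"
proof -
  interpret N: left_module R "M\<lparr>carrier := S\<rparr>"
    by (rule left_module_submodule[OF S])
  have sub: "left_submodule R (M\<lparr>carrier := S\<rparr>) T \<longleftrightarrow> left_submodule R M T \<and> T \<subseteq> S" for T
    using left_submodule_subset[OF S] by (auto simp: left_submodule_def)
  have int: "left_submodule R M (T \<inter> S)" if "left_submodule R M T" for T
    using that S by (auto simp: left_submodule_def)
  show ?thesis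
    unfolding N.fin_gen_module_iff fin_gen_submodule_def sub
  proof (simp, intro ex_cong1 conj_cong refl iffI allI impI)
    fix X T
    assume X: "X \<subseteq> S"
      and *: "\<forall>T. left_submodule R M T \<and> T \<subseteq> S \<longrightarrow> X \<subseteq> T \<longrightarrow> S \<subseteq> T"
      and T: "left_submodule R M T" "X \<subseteq> T"
    have "S \<subseteq> T \<inter> S"
      by (rule *[rule_format]) (use int[OF T(1)] X T(2) in auto)
    then show "S \<subseteq> T"
      by blast
  qed auto
qed

end

section \<open>Free modules and the ring as a left module over itself\<close>

lemma free_mod_sel [simp]:
  "\<zero>\<^bsub>free_mod R I\<^esub> = (\<lambda>i. \<zero>\<^bsub>R\<^esub>)"
  "c \<oplus>\<^bsub>free_mod R I\<^esub> d = (\<lambda>i. c i \<oplus>\<^bsub>R\<^esub> d i)"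
  "a \<odot>\<^bsub>free_mod R I\<^esub> c = (\<lambda>i. a \<otimes>\<^bsub>R\<^esub> c i)"
  by (simp_all add: free_mod_def)

lemma carrier_free_mod_finite:
  "finite I \<Longrightarrow> carrier (free_mod R I) =
    {c. (\<forall>i \<in> I. c i \<in> carrier R) \<and> (\<forall>i. i \<notin> I \<longrightarrow> c i = \<zero>\<^bsub>R\<^esub>)}"
  by (auto simp: free_mod_def intro: rev_finite_subset)

lemma (in ring) free_mod_carrierD: "c \<in> carrier (free_mod R I) \<Longrightarrow> c i \<in> carrier R"
  by (cases "i \<in> I") (auto simp: free_mod_def)

lemma left_module_free_mod:
  assumes "ring R"
  shows "left_module R (free_mod R I)"
proof -
  interpret ring R by fact
  let ?F = "free_mod R I"
  note cl = free_mod_carrierD[of _ I]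
  have fin: "finite {i. f (c i) (d i) \<noteq> \<zero>\<^bsub>R\<^esub>}"
    if "c \<in> carrier ?F" "d \<in> carrier ?F" "f \<zero>\<^bsub>R\<^esub> \<zero>\<^bsub>R\<^esub> = \<zero>\<^bsub>R\<^esub>" for c d f
  proof (rule finite_subset)
    show "finite ({i. c i \<noteq> \<zero>\<^bsub>R\<^esub>} \<union> {i. d i \<noteq> \<zero>\<^bsub>R\<^esub>})"
      using that by (simp add: free_mod_def)
  qed (use that(3) in auto)
  \<comment> \<open>One closure statement serves sums, negatives and scalar multiples; the unary
    operations are read as binary ones that ignore their second argument.\<close>
  have mem: "(\<lambda>i. f (c i) (d i)) \<in> carrier ?F"
    if "c \<in> carrier ?F" "d \<in> carrier ?F" "f \<zero>\<^bsub>R\<^esub> \<zero>\<^bsub>R\<^esub> = \<zero>\<^bsub>R\<^esub>"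
      "\<And>a b. a \<in> carrier R \<Longrightarrow> b \<in> carrier R \<Longrightarrow> f a b \<in> carrier R" for c d f
    using fin[of c d f] that by (simp add: free_mod_def)
  have "abelian_group ?F"
  proof (rule abelian_groupI)
    fix x assume x: "x \<in> carrier ?F"
    have "(\<lambda>i. \<ominus>\<^bsub>R\<^esub> x i) \<in> carrier ?F"
      using mem[of x x "\<lambda>a b. \<ominus>\<^bsub>R\<^esub> a"] x by simp
    then show "\<exists>y \<in> carrier ?F. y \<oplus>\<^bsub>?F\<^esub> x = \<zero>\<^bsub>?F\<^esub>"
      by (rule rev_bexI) (simp add: l_neg cl[OF x])
  next
    fix x y assume "x \<in> carrier ?F" "y \<in> carrier ?F"
    then show "x \<oplus>\<^bsub>?F\<^esub> y \<in> carrier ?F"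
      using mem[of x y "\<lambda>a b. a \<oplus>\<^bsub>R\<^esub> b"] by simp
  next
    show "\<zero>\<^bsub>?F\<^esub> \<in> carrier ?F"
      by (simp add: free_mod_def)
  qed (simp_all add: cl a_ac)
  then show ?thesis
  proof (intro left_module.intro left_module_axioms.intro)
    fix a x assume "a \<in> carrier R" "x \<in> carrier ?F"
    then show "a \<odot>\<^bsub>?F\<^esub> x \<in> carrier ?F"
      using mem[of x x "\<lambda>u v. a \<otimes>\<^bsub>R\<^esub> u"] by simp
  qed (simp_all add: cl l_distr r_distr m_assoc ring_axioms)
qed

lemma left_ideal_module_sel [simp]:
  "carrier (left_ideal_module R I) = I"
  "\<zero>\<^bsub>left_ideal_module R I\<^esub> = \<zero>\<^bsub>R\<^esub>"
  "x \<oplus>\<^bsub>left_ideal_module R I\<^esub> y = x \<oplus>\<^bsub>R\<^esub> y"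
  "a \<odot>\<^bsub>left_ideal_module R I\<^esub> x = a \<otimes>\<^bsub>R\<^esub> x"
  by (simp_all add: left_ideal_module_def)

lemma left_module_ring:
  assumes "ring R"
  shows "left_module R (left_ideal_module R (carrier R))"
proof -
  interpret ring R by fact
  have "abelian_group (left_ideal_module R (carrier R))"
    by (intro abelian_groupI) (auto simp: a_ac intro: l_neg)
  then show ?thesis
    by (intro left_module.intro left_module_axioms.intro ring_axioms)
      (simp_all add: l_distr r_distr m_assoc)
qed

lemma fin_gen_module_ring:
  assumes "ring R"
  shows "fin_gen_module R (left_ideal_module R (carrier R))"
proof -
  interpret ring R by fact
  interpret L: left_module R "left_ideal_module R (carrier R)"
    by (rule left_module_ring[OF assms])
  have "carrier R \<subseteq> T" if "left_submodule R (left_ideal_module R (carrier R)) T" "\<one>\<^bsub>R\<^esub> \<in> T" for T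
  proof
    fix a assume "a \<in> carrier R"
    then show "a \<in> T"
      using left_submodule_smult[OF that(1) _ that(2), of a]
      by simp
  qed
  then show ?thesis
    unfolding L.fin_gen_module_iff fin_gen_submodule_def
    by (intro exI[of _ "{\<one>\<^bsub>R\<^esub>}"]) auto
qed

section \<open>Linear maps, kernels and coherence\<close>

lemma left_module_homD:
  assumes "f \<in> left_module_hom R M N"
  shows left_module_hom_closed: "x \<in> carrier M \<Longrightarrow> f x \<in> carrier N"
    and left_module_hom_add:
      "x \<in> carrier M \<Longrightarrow> y \<in> carrier M \<Longrightarrow> f (x \<oplus>\<^bsub>M\<^esub> y) = f x \<oplus>\<^bsub>N\<^esub> f y"
    and left_module_hom_smult:
      "a \<in> carrier R \<Longrightarrow> x \<in> carrier M \<Longrightarrow> f (a \<odot>\<^bsub>M\<^esub> x) = a \<odot>\<^bsub>N\<^esub> f x"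
  using assms by (auto simp: left_module_hom_def)

lemma left_submodule_kernel:
  assumes M: "left_module R M" and N: "left_module R N" and f: "f \<in> left_module_hom R M N"
  shows "left_submodule R M {x \<in> carrier M. f x = \<zero>\<^bsub>N\<^esub>}"
proof -
  interpret M: left_module R M by fact
  interpret N: left_module R N by fact
  note f' = left_module_homD[OF f]
  \<comment> \<open>Preservation of zero is not a clause of \<open>left_module_hom\<close>; it
    follows from additivity by cancellation.\<close>
  have "f \<zero>\<^bsub>M\<^esub> \<oplus>\<^bsub>N\<^esub> f \<zero>\<^bsub>M\<^esub> = f \<zero>\<^bsub>M\<^esub>"
    using f'(2)[of "\<zero>\<^bsub>M\<^esub>" "\<zero>\<^bsub>M\<^esub>"] by simp
  then have "f \<zero>\<^bsub>M\<^esub> = \<zero>\<^bsub>N\<^esub>"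
    using f'(1)[of "\<zero>\<^bsub>M\<^esub>"] by (metis M.M.zero_closed M.R.zero_closed N.M.add.r_cancel_one')
  then show ?thesis
    by (intro left_submoduleI) (auto simp: f' M.smult_closed N.smult_r_null)
qed

text \<open>A ring is generated by \<open>1\<close> as a module over itself, so only the condition
  on kernels remains. These are submodules of the free module, and their finite generation can be
  tested there.\<close>

lemma left_coherent_ring_iff:
  assumes "ring R"
  shows "left_coherent_ring R \<longleftrightarrow>
    (\<forall>n :: nat. \<forall>\<phi> \<in> left_module_hom R (free_mod R {..<n}) (left_ideal_module R (carrier R)).
      fin_gen_submodule R (free_mod R {..<n}) {p \<in> carrier (free_mod R {..<n}). \<phi> p = \<zero>\<^bsub>R\<^esub>})"
proof -
  have "fin_gen_module R ((free_mod R {..<n})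
        \<lparr>carrier := {p \<in> carrier (free_mod R {..<n}). \<phi> p = \<zero>\<^bsub>R\<^esub>}\<rparr>) \<longleftrightarrow>
      fin_gen_submodule R (free_mod R {..<n}) {p \<in> carrier (free_mod R {..<n}). \<phi> p = \<zero>\<^bsub>R\<^esub>}"
    if "\<phi> \<in> left_module_hom R (free_mod R {..<n}) (left_ideal_module R (carrier R))"
    for n :: nat and \<phi>
    using left_module.fin_gen_module_submodule_iff[OF left_module_free_mod[OF assms]
        left_submodule_kernel[OF left_module_free_mod[OF assms] left_module_ring[OF assms] that]]
    by simp
  then show ?thesis
    unfolding left_coherent_ring_def coherent_module_def
    using fin_gen_module_ring[OF assms] by simp
qed

text \<open>Induction on the rank. The last coordinates of the elements of \<open>S\<close> form an
  ideal of \<open>K\<close>, which has finitely many generators. Their lifts to \<open>S\<close>,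
  together with generators of the part of \<open>S\<close> with vanishing last coordinate, generate
  \<open>S\<close>.\<close>

lemma noetherian_fin_gen_submodule:
  fixes K (structure)
  assumes "cring K" and "noetherian_ring K"
    and "left_submodule K (free_mod K {..<n::nat}) S"
  shows "fin_gen_submodule K (free_mod K {..<n}) S"
  using assms(3)
proof (induction n arbitrary: S)
  case 0
  have "S = {\<lambda>_. \<zero>}"
    using left_submodule_subset[OF 0] left_submodule_zero[OF 0] by (auto simp: free_mod_def)
  then show ?case
    unfolding fin_gen_submodule_def by auto
next
  case (Suc n)
  interpret cring K by fact
  interpret noetherian_ring K by fact
  let ?F = "free_mod K {..<n}" and ?G = "free_mod K {..<Suc n}"
  \<comment> \<open>Families are extended by zero, so the free module of rank \<open>n\<close> is
    literally a subset of the one of rank \<open>Suc n\<close>, and no inclusion map is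
    needed.\<close>
  have carr: "c \<in> carrier ?F \<longleftrightarrow> c \<in> carrier ?G \<and> c n = \<zero>" for c
    by (auto simp: carrier_free_mod_finite less_Suc_eq)
  have zero_iff: "left_submodule K ?F U \<longleftrightarrow> left_submodule K ?G U \<and> (\<forall>u \<in> U. u n = \<zero>)" for U
    unfolding left_submodule_def subset_iff carr free_mod_sel by blast
  have last: "ideal ((\<lambda>u. u n) ` U) K" if U: "left_submodule K ?G U" for U
  proof (rule idealI)
    have cl: "u i \<in> carrier K" if "u \<in> U" for u i
      by (rule free_mod_carrierD[OF left_submodule_carrier[OF U that]])
    have mult: "x \<otimes> a \<in> (\<lambda>u. u n) ` U" if "x \<in> carrier K" "a \<in> (\<lambda>u. u n) ` U" for x a
    proof -
      from that(2) obtain u where u: "u \<in> U" "a = u n" by blast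
      show ?thesis
        by (rule image_eqI[OF _ left_submodule_smult[OF U that(1) u(1)]]) (simp add: u(2))
    qed
    have car: "a \<in> carrier K" if "a \<in> (\<lambda>u. u n) ` U" for a
      using that cl by blast
    show "subgroup ((\<lambda>u. u n) ` U) (add_monoid K)"
    proof (rule add.subgroupI)
      show "(\<lambda>u. u n) ` U \<subseteq> carrier K"
        using car by blast
      show "(\<lambda>u. u n) ` U \<noteq> {}"
        using left_submodule_zero[OF U] by blast
    next
      fix a assume a: "a \<in> (\<lambda>u. u n) ` U"
      then show "\<ominus> a \<in> (\<lambda>u. u n) ` U"
        using mult[OF _ a, of "\<ominus> \<one>"] car[OF a] by (simp add: l_minus)
    next
      fix a b assume "a \<in> (\<lambda>u. u n) ` U" "b \<in> (\<lambda>u. u n) ` U"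
      then obtain u v where uv: "u \<in> U" "a = u n" "v \<in> U" "b = v n" by blast
      show "a \<oplus> b \<in> (\<lambda>u. u n) ` U"
        by (rule image_eqI[OF _ left_submodule_add[OF U uv(1,3)]]) (simp add: uv(2,4))
    qed
    show "x \<otimes> a \<in> (\<lambda>u. u n) ` U" "a \<otimes> x \<in> (\<lambda>u. u n) ` U"
      if "a \<in> (\<lambda>u. u n) ` U" "x \<in> carrier K" for a x
      using mult[OF that(2,1)] m_comm[OF that(2) car[OF that(1)]] by simp_all
  qed (rule ring_axioms)
  obtain Z where Z: "finite Z" "(\<lambda>s. s n) ` S = Idl Z" "Z \<subseteq> carrier K"
    using finetely_gen[OF last[OF Suc.prems]] by blast
  have "Z \<subseteq> (\<lambda>s. s n) ` S"
    unfolding Z(2) by (rule genideal_self[OF Z(3)])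
  then have "\<forall>z \<in> Z. \<exists>s \<in> S. s n = z"
    by blast
  then obtain lift where lift: "lift z \<in> S" "lift z n = z" if "z \<in> Z" for z
    by metis
  have S0: "left_submodule K ?F {s \<in> S. s n = \<zero>}"
    unfolding zero_iff using Suc.prems by (simp add: left_submodule_def subset_iff)
  obtain X where X: "X \<subseteq> {s \<in> S. s n = \<zero>}" "finite X"
    "\<And>T. left_submodule K ?F T \<Longrightarrow> X \<subseteq> T \<Longrightarrow> {s \<in> S. s n = \<zero>} \<subseteq> T"
    using Suc.IH[OF S0] unfolding fin_gen_submodule_def by blast
  interpret G: left_module K ?G
    by (rule left_module_free_mod[OF ring_axioms])
  have "S \<subseteq> T" if T: "left_submodule K ?G T" "X \<union> lift ` Z \<subseteq> T" for T
  proof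
    fix s assume s: "s \<in> S"
    \<comment> \<open>Intersecting with \<open>S\<close> yields an element \<open>t\<close> that
      lies in \<open>T\<close> and in \<open>S\<close> and has the last coordinate of
      \<open>s\<close>; then \<open>s - t\<close> stays in \<open>S\<close>.\<close>
    have TS: "left_submodule K ?G (T \<inter> S)"
      using T(1) Suc.prems by (simp add: left_submodule_def subset_iff)
    have "Z \<subseteq> (\<lambda>u. u n) ` (T \<inter> S)"
    proof
      fix z assume z: "z \<in> Z"
      then have "lift z \<in> T \<inter> S"
        using lift(1) T(2) by blast
      then show "z \<in> (\<lambda>u. u n) ` (T \<inter> S)"
        by (rule image_eqI[rotated]) (simp add: lift(2)[OF z])
    qed
    then have "(\<lambda>s. s n) ` S \<subseteq> (\<lambda>u. u n) ` (T \<inter> S)"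
      unfolding Z(2) by (rule genideal_minimal[OF last[OF TS]])
    then have "s n \<in> (\<lambda>u. u n) ` (T \<inter> S)"
      using s by blast
    then obtain t where t: "t \<in> T" "t \<in> S" "t n = s n"
      by (elim imageE IntE) simp
    have mem: "s \<in> carrier ?G" "t \<in> carrier ?G"
      using s t left_submodule_carrier[OF Suc.prems] by auto
    let ?d = "(\<ominus> \<one>) \<odot>\<^bsub>?G\<^esub> t \<oplus>\<^bsub>?G\<^esub> s"
    have "?d \<in> S"
      by (intro left_submodule_add[OF Suc.prems] left_submodule_smult[OF Suc.prems] s t(2)
          add.inv_closed one_closed)
    moreover have "?d n = \<zero>"
      using free_mod_carrierD[OF mem(1), of n] t(3) by (simp add: l_minus l_neg)
    \<comment> \<open>The induction hypothesis speaks of submodules of \<open>?F\<close>. Since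
      \<open>T\<close> is a submodule of \<open>?G\<close>, it is first cut down to elements with
      zero last coordinate.\<close>
    moreover have "{s \<in> S. s n = \<zero>} \<subseteq> {s \<in> S. s n = \<zero>} \<inter> T"
    proof (rule X(3))
      show "left_submodule K ?F ({s \<in> S. s n = \<zero>} \<inter> T)"
        unfolding zero_iff using Suc.prems T(1) by (simp add: left_submodule_def subset_iff)
    qed (use X(1) T(2) in blast)
    ultimately have "?d \<in> T"
      by blast
    then have "t \<oplus>\<^bsub>?G\<^esub> ?d \<in> T"
      by (rule left_submodule_add[OF T(1) t(1)])
    moreover have "t \<oplus>\<^bsub>?G\<^esub> ?d = s"
      unfolding G.smult_minus_one[OF mem(2)] using mem by (rule G.M.r_neg2[rotated])
    ultimately show "s \<in> T"
      by simp
  qed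
  moreover have "X \<union> lift ` Z \<subseteq> S" "finite (X \<union> lift ` Z)"
    using X(1,2) Z(1) lift by auto
  ultimately show ?case
    unfolding fin_gen_submodule_def by (intro exI[of _ "X \<union> lift ` Z"]) auto
qed


section \<open>The unital homotope\<close>

lemma unital_homotope_sel [simp]:
  "carrier (unital_homotope K A \<Delta>) = carrier K \<times> carrier A"
  "\<zero>\<^bsub>unital_homotope K A \<Delta>\<^esub> = (\<zero>\<^bsub>K\<^esub>, \<zero>\<^bsub>A\<^esub>)"
  "\<one>\<^bsub>unital_homotope K A \<Delta>\<^esub> = (\<one>\<^bsub>K\<^esub>, \<zero>\<^bsub>A\<^esub>)"
  "p \<oplus>\<^bsub>unital_homotope K A \<Delta>\<^esub> q = (fst p \<oplus>\<^bsub>K\<^esub> fst q, snd p \<oplus>\<^bsub>A\<^esub> snd q)"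
  "p \<otimes>\<^bsub>unital_homotope K A \<Delta>\<^esub> q = (fst p \<otimes>\<^bsub>K\<^esub> fst q,
    fst p \<odot>\<^bsub>A\<^esub> snd q \<oplus>\<^bsub>A\<^esub> fst q \<odot>\<^bsub>A\<^esub> snd p \<oplus>\<^bsub>A\<^esub> snd p \<otimes>\<^bsub>A\<^esub> \<Delta> \<otimes>\<^bsub>A\<^esub> snd q)"
  by (simp_all add: unital_homotope_def unitization_def homotope_def case_prod_unfold)

locale algebra_homotope = unital_algebra K A
  for K :: "('k, 's) ring_scheme" (structure) and A :: "('k, 'a) module" (structure) +
  fixes \<Delta> :: 'a
  assumes \<Delta>: "\<Delta> \<in> carrier A"
begin

text \<open>This is the \<open>A\<close>-component of associativity in the unitization. Both sides
  expand to the same seven terms: one for each of \<open>x\<close>, \<open>y\<close>,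
  \<open>z\<close>, one for each of the three pairs, and
  \<open>x \<Delta> y \<Delta> z\<close>.\<close>

lemma unital_homotope_assoc:
  assumes "k \<in> carrier K" "l \<in> carrier K" "m \<in> carrier K"
    and "x \<in> carrier A" "y \<in> carrier A" "z \<in> carrier A"
  shows "(k \<otimes> l) \<odot>\<^bsub>A\<^esub> z \<oplus>\<^bsub>A\<^esub> m \<odot>\<^bsub>A\<^esub> (k \<odot>\<^bsub>A\<^esub> y \<oplus>\<^bsub>A\<^esub> l \<odot>\<^bsub>A\<^esub> x \<oplus>\<^bsub>A\<^esub> x \<otimes>\<^bsub>A\<^esub> \<Delta> \<otimes>\<^bsub>A\<^esub> y) \<oplus>\<^bsub>A\<^esub>
      (k \<odot>\<^bsub>A\<^esub> y \<oplus>\<^bsub>A\<^esub> l \<odot>\<^bsub>A\<^esub> x \<oplus>\<^bsub>A\<^esub> x \<otimes>\<^bsub>A\<^esub> \<Delta> \<otimes>\<^bsub>A\<^esub> y) \<otimes>\<^bsub>A\<^esub> \<Delta> \<otimes>\<^bsub>A\<^esub> z =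
    k \<odot>\<^bsub>A\<^esub> (l \<odot>\<^bsub>A\<^esub> z \<oplus>\<^bsub>A\<^esub> m \<odot>\<^bsub>A\<^esub> y \<oplus>\<^bsub>A\<^esub> y \<otimes>\<^bsub>A\<^esub> \<Delta> \<otimes>\<^bsub>A\<^esub> z) \<oplus>\<^bsub>A\<^esub> (l \<otimes> m) \<odot>\<^bsub>A\<^esub> x \<oplus>\<^bsub>A\<^esub>
      x \<otimes>\<^bsub>A\<^esub> \<Delta> \<otimes>\<^bsub>A\<^esub> (l \<odot>\<^bsub>A\<^esub> z \<oplus>\<^bsub>A\<^esub> m \<odot>\<^bsub>A\<^esub> y \<oplus>\<^bsub>A\<^esub> y \<otimes>\<^bsub>A\<^esub> \<Delta> \<otimes>\<^bsub>A\<^esub> z)"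
proof -
  \<comment> \<open>Scalars commute; these two instances put nested scalars into the same order on
    both sides.\<close>
  have lm: "(l \<otimes> m) \<odot>\<^bsub>A\<^esub> x = m \<odot>\<^bsub>A\<^esub> (l \<odot>\<^bsub>A\<^esub> x)" and mk: "m \<odot>\<^bsub>A\<^esub> (k \<odot>\<^bsub>A\<^esub> y) = k \<odot>\<^bsub>A\<^esub> (m \<odot>\<^bsub>A\<^esub> y)"
    using assms by (simp_all add: R.m_comm flip: smult_assoc1)
  show ?thesis
    using assms \<Delta>
    by (simp add: lm mk smult_assoc1[of k l z] smult_r_distr smult_mult_left smult_mult_right
        A.l_distr A.r_distr A.m_assoc M.a_ac)
qed

lemma ring_unital_homotope: "ring (unital_homotope K A \<Delta>)"
proof (rule ringI)
  show "abelian_group (unital_homotope K A \<Delta>)"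
  proof (rule abelian_groupI)
    fix p assume "p \<in> carrier (unital_homotope K A \<Delta>)"
    then show "\<exists>q \<in> carrier (unital_homotope K A \<Delta>).
        q \<oplus>\<^bsub>unital_homotope K A \<Delta>\<^esub> p = \<zero>\<^bsub>unital_homotope K A \<Delta>\<^esub>"
      by (intro bexI[of _ "(\<ominus>\<^bsub>K\<^esub> fst p, \<ominus>\<^bsub>A\<^esub> snd p)"])
        (simp_all add: mem_Times_iff R.l_neg M.l_neg)
  qed (simp_all add: mem_Times_iff R.a_ac M.a_ac)
  show "monoid (unital_homotope K A \<Delta>)"
  proof (rule monoidI)
    fix p q r
    assume "p \<in> carrier (unital_homotope K A \<Delta>)" "q \<in> carrier (unital_homotope K A \<Delta>)"
      "r \<in> carrier (unital_homotope K A \<Delta>)"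
    then show "p \<otimes>\<^bsub>unital_homotope K A \<Delta>\<^esub> q \<otimes>\<^bsub>unital_homotope K A \<Delta>\<^esub> r =
        p \<otimes>\<^bsub>unital_homotope K A \<Delta>\<^esub> (q \<otimes>\<^bsub>unital_homotope K A \<Delta>\<^esub> r)"
      unfolding unital_homotope_sel mem_Times_iff fst_conv snd_conv prod.inject
      by (intro conjI R.m_assoc unital_homotope_assoc; blast)
  qed (simp_all add: mem_Times_iff \<Delta>)
qed (simp_all add: mem_Times_iff \<Delta> R.l_distr R.r_distr smult_r_distr smult_l_distr
      A.l_distr A.r_distr M.a_ac)

text \<open>The quantification over \<open>P\<close> encodes that \<open>u\<close> is a sum of elements of \<open>A \<Delta> Y\<close>; it is applied to
  statements that are additive in \<open>u\<close>.\<close>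

lemma homotope_ideal_prod_generators:
  assumes u: "u \<in> carrier A \<cdot>\<^bsub>homotope A \<Delta>\<^esub> carrier A"
  shows "\<exists>Y \<subseteq> carrier A. finite Y \<and> (\<forall>P.
    (\<forall>x \<in> carrier A. \<forall>y \<in> Y. P (x \<otimes>\<^bsub>A\<^esub> \<Delta> \<otimes>\<^bsub>A\<^esub> y)) \<longrightarrow>
    (\<forall>v \<in> carrier A. \<forall>w \<in> carrier A. P v \<longrightarrow> P w \<longrightarrow> P (v \<oplus>\<^bsub>A\<^esub> w)) \<longrightarrow> P u)"
proof -
  define Q where "Q Y u \<longleftrightarrow> (\<forall>P.
    (\<forall>x \<in> carrier A. \<forall>y \<in> Y. P (x \<otimes>\<^bsub>A\<^esub> \<Delta> \<otimes>\<^bsub>A\<^esub> y)) \<longrightarrow>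
    (\<forall>v \<in> carrier A. \<forall>w \<in> carrier A. P v \<longrightarrow> P w \<longrightarrow> P (v \<oplus>\<^bsub>A\<^esub> w)) \<longrightarrow> P u)" for Y u
  \<comment> \<open>The assumption on products for \<open>Y \<union> Z\<close> implies the one for
    each of \<open>Y\<close> and \<open>Z\<close>, so the sets of right factors of two sums can be
    united.\<close>
  have Q_add: "Q (Y \<union> Z) (s \<oplus>\<^bsub>A\<^esub> t)"
    if "Q Y s" "Q Z t" and st: "s \<in> carrier A" "t \<in> carrier A" for Y Z s t
    unfolding Q_def
  proof (intro allI impI)
    fix P
    assume prod: "\<forall>x \<in> carrier A. \<forall>y \<in> Y \<union> Z. P (x \<otimes>\<^bsub>A\<^esub> \<Delta> \<otimes>\<^bsub>A\<^esub> y)"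
      and add: "\<forall>v \<in> carrier A. \<forall>w \<in> carrier A. P v \<longrightarrow> P w \<longrightarrow> P (v \<oplus>\<^bsub>A\<^esub> w)"
    have "P s"
      by (rule \<open>Q Y s\<close>[unfolded Q_def, rule_format]) (use prod add in simp_all)
    moreover have "P t"
      by (rule \<open>Q Z t\<close>[unfolded Q_def, rule_format]) (use prod add in simp_all)
    ultimately show "P (s \<oplus>\<^bsub>A\<^esub> t)"
      using add st by simp
  qed
  \<comment> \<open>Membership in \<open>A\<close> is carried along because the additivity assumed
    of \<open>P\<close> concerns elements of \<open>A\<close> only.\<close>
  have "u \<in> carrier A \<and> (\<exists>Y \<subseteq> carrier A. finite Y \<and> Q Y u)"
    using u
  proof (induction rule: ideal_prod.induct)
    case (prod x y)
    have "Q {y} (x \<otimes>\<^bsub>A\<^esub> \<Delta> \<otimes>\<^bsub>A\<^esub> y)"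
      using prod(1) by (simp add: Q_def)
    then show ?case
      using prod \<Delta> by (intro conjI exI[of _ "{y}"]) (simp_all add: homotope_def)
  next
    case (sum s t)
    from sum.IH obtain Y Z where "Y \<subseteq> carrier A" "finite Y" "Q Y s"
      "Z \<subseteq> carrier A" "finite Z" "Q Z t" "s \<in> carrier A" "t \<in> carrier A"
      by (elim conjE exE)
    then show ?case
      by (intro conjI exI[of _ "Y \<union> Z"]) (simp_all add: homotope_def Q_add)
  qed
  then show ?thesis
    by (simp only: Q_def)
qed

theorem left_coherent_unital_homotope:
  assumes "noetherian_ring K"
    and idem: "carrier A \<cdot>\<^bsub>homotope A \<Delta>\<^esub> carrier A = carrier A"
    and coh: "left_coherent_ring A"
  shows "left_coherent_ring (unital_homotope K A \<Delta>)"
proof -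
  let ?B = "unital_homotope K A \<Delta>"
  interpret B: ring ?B
    by (rule ring_unital_homotope)
  have "\<one>\<^bsub>A\<^esub> \<in> carrier A \<cdot>\<^bsub>homotope A \<Delta>\<^esub> carrier A"
    unfolding idem by (rule A.one_closed)
  from homotope_ideal_prod_generators[OF this] obtain Y where Y: "Y \<subseteq> carrier A" "finite Y"
    and "\<forall>P. (\<forall>x \<in> carrier A. \<forall>y \<in> Y. P (x \<otimes>\<^bsub>A\<^esub> \<Delta> \<otimes>\<^bsub>A\<^esub> y)) \<longrightarrow>
      (\<forall>v \<in> carrier A. \<forall>w \<in> carrier A. P v \<longrightarrow> P w \<longrightarrow> P (v \<oplus>\<^bsub>A\<^esub> w)) \<longrightarrow> P \<one>\<^bsub>A\<^esub>"
    by (elim exE conjE)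
  \<comment> \<open>This stands for \<open>1 = \<Sum> x\<^sub>i \<Delta> y\<^sub>i\<close>, with
    \<open>Y\<close> the set of the \<open>y\<^sub>i\<close>: a property that is additive in
    \<open>u\<close> and holds for every \<open>u = a \<Delta> y\<close> with \<open>y\<close> in
    \<open>Y\<close> holds for \<open>u = 1\<close>.\<close>
  note gen = this(3)[rule_format]
  have "fin_gen_submodule ?B (free_mod ?B {..<n}) {p \<in> carrier (free_mod ?B {..<n}). \<phi> p = \<zero>\<^bsub>?B\<^esub>}"
    if \<phi>: "\<phi> \<in> left_module_hom ?B (free_mod ?B {..<n}) (left_ideal_module ?B (carrier ?B))"
    for n :: nat and \<phi>
  proof -
    let ?FA = "free_mod A {..<n}" and ?FB = "free_mod ?B {..<n}" and ?FK = "free_mod K {..<n}"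
    interpret FA: left_module A ?FA
      by (rule left_module_free_mod[OF A.ring_axioms])
    interpret FB: left_module ?B ?FB
      by (rule left_module_free_mod[OF B.ring_axioms])

    \<comment> \<open>The kernel of \<open>\<phi>\<close> and the linearity of
      \<open>\<phi>\<close>\<close>
    define N where "N = {p \<in> carrier ?FB. \<phi> p = \<zero>\<^bsub>?B\<^esub>}"
    have N: "left_submodule ?B ?FB N"
      using left_submodule_kernel[OF left_module_free_mod[OF B.ring_axioms]
          left_module_ring[OF B.ring_axioms] \<phi>] by (simp add: N_def)
    have \<phi>_closed: "\<phi> p \<in> carrier K \<times> carrier A" if "p \<in> carrier ?FB" for p
      using left_module_hom_closed[OF \<phi> that] by simp
    have \<phi>_add: "\<phi> (p \<oplus>\<^bsub>?FB\<^esub> q) = \<phi> p \<oplus>\<^bsub>?B\<^esub> \<phi> q"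
      if "p \<in> carrier ?FB" "q \<in> carrier ?FB" for p q
      using left_module_hom_add[OF \<phi> that] by (simp only: left_ideal_module_sel)
    have \<phi>_smult: "\<phi> (b \<odot>\<^bsub>?FB\<^esub> p) = b \<otimes>\<^bsub>?B\<^esub> \<phi> p"
      if "b \<in> carrier ?B" "p \<in> carrier ?FB" for b p
      using left_module_hom_smult[OF \<phi> that] by (simp only: left_ideal_module_sel)

    \<comment> \<open>The restriction of \<open>\<phi>\<close> to \<open>A^n\<close> and its
      linearity over \<open>A\<close>\<close>
    define emb :: "(nat \<Rightarrow> 'a) \<Rightarrow> nat \<Rightarrow> 'k \<times> 'a" where "emb x = (\<lambda>i. (\<zero>\<^bsub>K\<^esub>, x i))" for x
    \<comment> \<open>\<open>emb\<close> identifies \<open>A^n\<close> with the submodule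
      \<open>(B^+)^n\<close> of \<open>B^n\<close>. Taking \<open>snd\<close> loses nothing, since
      \<open>fst_\<phi>\<close> below shows that \<open>\<phi>\<close> maps this submodule into
      \<open>B^+\<close>.\<close>
    define \<psi> where "\<psi> x = snd (\<phi> (emb x))" for x
    have cl: "x i \<in> carrier A" if "x \<in> carrier ?FA" for x i
      by (rule A.free_mod_carrierD[OF that])
    have emb_closed: "emb x \<in> carrier ?FB" if "x \<in> carrier ?FA" for x
      using that by (simp add: emb_def carrier_free_mod_finite)
    have emb_add: "emb (x \<oplus>\<^bsub>?FA\<^esub> y) = emb x \<oplus>\<^bsub>?FB\<^esub> emb y" for x y
      by (simp add: emb_def)
    \<comment> \<open>This bridges the two module structures: \<open>a \<Delta> y\<close> acting
      over \<open>A\<close> on \<open>x\<close> is \<open>(0, a)\<close> acting over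
      \<open>B\<close> on \<open>y x\<close>, where the linearity of \<open>\<phi>\<close>
      applies.\<close>
    have emb_smult: "emb ((a \<otimes>\<^bsub>A\<^esub> \<Delta> \<otimes>\<^bsub>A\<^esub> y) \<odot>\<^bsub>?FA\<^esub> x) = (\<zero>\<^bsub>K\<^esub>, a) \<odot>\<^bsub>?FB\<^esub> emb (y \<odot>\<^bsub>?FA\<^esub> x)"
      if "a \<in> carrier A" "y \<in> carrier A" "x \<in> carrier ?FA" for a y x
      using that \<Delta> by (simp add: emb_def cl A.m_assoc)
    have emb_distr: "emb ((u \<oplus>\<^bsub>A\<^esub> v) \<odot>\<^bsub>?FA\<^esub> x) = emb (u \<odot>\<^bsub>?FA\<^esub> x) \<oplus>\<^bsub>?FB\<^esub> emb (v \<odot>\<^bsub>?FA\<^esub> x)"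
      if "u \<in> carrier A" "v \<in> carrier A" "x \<in> carrier ?FA" for u v x
      unfolding emb_add[symmetric] FA.smult_l_distr[OF that] ..
    note sc = FA.smult_closed
    have fst_\<phi>: "fst (\<phi> (emb x)) = \<zero>\<^bsub>K\<^esub>" if x: "x \<in> carrier ?FA" for x
    proof -
      have "fst (\<phi> (emb (\<one>\<^bsub>A\<^esub> \<odot>\<^bsub>?FA\<^esub> x))) = \<zero>\<^bsub>K\<^esub>"
      \<comment> \<open>For \<open>u = a \<Delta> y\<close> the value is a left multiple of
        \<open>(0, a)\<close>, hence lies in the ideal \<open>B^+\<close>.\<close>
      proof (rule gen[of "\<lambda>u. fst (\<phi> (emb (u \<odot>\<^bsub>?FA\<^esub> x))) = \<zero>\<^bsub>K\<^esub>"])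
        fix a y assume a: "a \<in> carrier A" and "y \<in> Y"
        with Y have y: "y \<in> carrier A" by blast
        have e: "emb (y \<odot>\<^bsub>?FA\<^esub> x) \<in> carrier ?FB"
          by (intro emb_closed sc y x)
        have "\<phi> (emb ((a \<otimes>\<^bsub>A\<^esub> \<Delta> \<otimes>\<^bsub>A\<^esub> y) \<odot>\<^bsub>?FA\<^esub> x)) = (\<zero>\<^bsub>K\<^esub>, a) \<otimes>\<^bsub>?B\<^esub> \<phi> (emb (y \<odot>\<^bsub>?FA\<^esub> x))"
          unfolding emb_smult[OF a y x] using a by (intro \<phi>_smult e) simp
        then show "fst (\<phi> (emb ((a \<otimes>\<^bsub>A\<^esub> \<Delta> \<otimes>\<^bsub>A\<^esub> y) \<odot>\<^bsub>?FA\<^esub> x))) = \<zero>\<^bsub>K\<^esub>"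
          using \<phi>_closed[OF e] by (simp only: unital_homotope_sel fst_conv mem_Times_iff R.l_null)
      next
        fix v w assume v: "v \<in> carrier A" and w: "w \<in> carrier A"
          and "fst (\<phi> (emb (v \<odot>\<^bsub>?FA\<^esub> x))) = \<zero>\<^bsub>K\<^esub>" "fst (\<phi> (emb (w \<odot>\<^bsub>?FA\<^esub> x))) = \<zero>\<^bsub>K\<^esub>"
        then show "fst (\<phi> (emb ((v \<oplus>\<^bsub>A\<^esub> w) \<odot>\<^bsub>?FA\<^esub> x))) = \<zero>\<^bsub>K\<^esub>"
          unfolding emb_distr[OF v w x] \<phi>_add[OF emb_closed[OF sc[OF v x]] emb_closed[OF sc[OF w x]]]
          by (simp only: unital_homotope_sel fst_conv R.l_zero R.zero_closed)
      qed
      then show ?thesis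
        by (simp only: FA.smult_one[OF x])
    qed
    have \<psi>_closed: "\<psi> x \<in> carrier A" if "x \<in> carrier ?FA" for x
      using \<phi>_closed[OF emb_closed[OF that]] by (simp add: \<psi>_def mem_Times_iff)
    have \<psi>_add: "\<psi> (x \<oplus>\<^bsub>?FA\<^esub> y) = \<psi> x \<oplus>\<^bsub>A\<^esub> \<psi> y"
      if "x \<in> carrier ?FA" "y \<in> carrier ?FA" for x y
      unfolding \<psi>_def emb_add \<phi>_add[OF emb_closed[OF that(1)] emb_closed[OF that(2)]]
      by (simp only: unital_homotope_sel snd_conv)
    have \<psi>_homotope: "\<psi> ((a \<otimes>\<^bsub>A\<^esub> \<Delta> \<otimes>\<^bsub>A\<^esub> y) \<odot>\<^bsub>?FA\<^esub> x) = a \<otimes>\<^bsub>A\<^esub> \<Delta> \<otimes>\<^bsub>A\<^esub> \<psi> (y \<odot>\<^bsub>?FA\<^esub> x)"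
      if a: "a \<in> carrier A" and y: "y \<in> carrier A" and x: "x \<in> carrier ?FA" for a y x
    proof -
      have "\<phi> (emb ((a \<otimes>\<^bsub>A\<^esub> \<Delta> \<otimes>\<^bsub>A\<^esub> y) \<odot>\<^bsub>?FA\<^esub> x)) = (\<zero>\<^bsub>K\<^esub>, a) \<otimes>\<^bsub>?B\<^esub> \<phi> (emb (y \<odot>\<^bsub>?FA\<^esub> x))"
        unfolding emb_smult[OF a y x] using a by (intro \<phi>_smult emb_closed sc y x) simp
      \<comment> \<open>As \<open>\<phi> (emb (y x))\<close> has zero \<open>K\<close>-component,
        its product with \<open>(0, a)\<close> has no scalar terms and only
        \<open>a \<Delta> \<psi> (y x)\<close> is left.\<close>
      then show ?thesis
        using \<psi>_closed[OF sc[OF y x]] a \<Delta> fst_\<phi>[OF sc[OF y x]]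
        by (simp add: \<psi>_def del: free_mod_sel)
    qed
    have \<psi>_smult: "\<psi> (a \<odot>\<^bsub>?FA\<^esub> x) = a \<otimes>\<^bsub>A\<^esub> \<psi> x" if a: "a \<in> carrier A" and x: "x \<in> carrier ?FA" for a x
    proof -
      have "\<psi> ((a \<otimes>\<^bsub>A\<^esub> \<one>\<^bsub>A\<^esub>) \<odot>\<^bsub>?FA\<^esub> x) = a \<otimes>\<^bsub>A\<^esub> \<psi> (\<one>\<^bsub>A\<^esub> \<odot>\<^bsub>?FA\<^esub> x)"
      \<comment> \<open>Both sides are additive in \<open>u\<close>. For
        \<open>u = b \<Delta> y\<close>, applying \<open>\<psi>_homotope\<close> with
        \<open>a b\<close> on the left and with \<open>b\<close> on the right gives
        \<open>a b \<Delta> \<psi> (y x)\<close> in both cases.\<close>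
      proof (rule gen[of "\<lambda>u. \<psi> ((a \<otimes>\<^bsub>A\<^esub> u) \<odot>\<^bsub>?FA\<^esub> x) = a \<otimes>\<^bsub>A\<^esub> \<psi> (u \<odot>\<^bsub>?FA\<^esub> x)"])
        fix b y assume b: "b \<in> carrier A" and "y \<in> Y"
        with Y have y: "y \<in> carrier A" by blast
        have eq: "a \<otimes>\<^bsub>A\<^esub> (b \<otimes>\<^bsub>A\<^esub> \<Delta> \<otimes>\<^bsub>A\<^esub> y) = (a \<otimes>\<^bsub>A\<^esub> b) \<otimes>\<^bsub>A\<^esub> \<Delta> \<otimes>\<^bsub>A\<^esub> y"
          using a b y \<Delta> by (simp add: A.m_assoc)
        show "\<psi> ((a \<otimes>\<^bsub>A\<^esub> (b \<otimes>\<^bsub>A\<^esub> \<Delta> \<otimes>\<^bsub>A\<^esub> y)) \<odot>\<^bsub>?FA\<^esub> x) =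
            a \<otimes>\<^bsub>A\<^esub> \<psi> ((b \<otimes>\<^bsub>A\<^esub> \<Delta> \<otimes>\<^bsub>A\<^esub> y) \<odot>\<^bsub>?FA\<^esub> x)"
          unfolding eq \<psi>_homotope[OF A.m_closed[OF a b] y x] \<psi>_homotope[OF b y x]
          using a b \<Delta> \<psi>_closed[OF sc[OF y x]] by (simp add: A.m_assoc del: free_mod_sel)
      next
        fix v w assume v: "v \<in> carrier A" and w: "w \<in> carrier A"
          and IH: "\<psi> ((a \<otimes>\<^bsub>A\<^esub> v) \<odot>\<^bsub>?FA\<^esub> x) = a \<otimes>\<^bsub>A\<^esub> \<psi> (v \<odot>\<^bsub>?FA\<^esub> x)"
            "\<psi> ((a \<otimes>\<^bsub>A\<^esub> w) \<odot>\<^bsub>?FA\<^esub> x) = a \<otimes>\<^bsub>A\<^esub> \<psi> (w \<odot>\<^bsub>?FA\<^esub> x)"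
        show "\<psi> ((a \<otimes>\<^bsub>A\<^esub> (v \<oplus>\<^bsub>A\<^esub> w)) \<odot>\<^bsub>?FA\<^esub> x) = a \<otimes>\<^bsub>A\<^esub> \<psi> ((v \<oplus>\<^bsub>A\<^esub> w) \<odot>\<^bsub>?FA\<^esub> x)"
          using a v w x IH
          by (simp add: A.r_distr FA.smult_l_distr \<psi>_add \<psi>_closed sc del: free_mod_sel)
      qed
      then show ?thesis
        using a by (simp only: FA.smult_one[OF x] A.r_one)
    qed
    have \<psi>: "\<psi> \<in> left_module_hom A ?FA (left_ideal_module A (carrier A))"
      unfolding left_module_hom_def left_ideal_module_sel
      using \<psi>_closed \<psi>_add \<psi>_smult by blast

    \<comment> \<open>The intersection of the kernel with \<open>(B^+)^n\<close>, finitely generated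
      over \<open>A\<close>\<close>
    define L where "L = {x \<in> carrier ?FA. \<psi> x = \<zero>\<^bsub>A\<^esub>}"
    have L: "left_submodule A ?FA L"
      using left_submodule_kernel[OF left_module_free_mod[OF A.ring_axioms]
          left_module_ring[OF A.ring_axioms] \<psi>] by (simp add: L_def)
    \<comment> \<open>Here \<open>\<phi> (emb x) = (0, \<psi> x)\<close>, so \<open>emb\<close>
      identifies \<open>L\<close> with the intersection of \<open>N\<close> and
      \<open>(B^+)^n\<close>.\<close>
    have emb_N_iff: "emb x \<in> N \<longleftrightarrow> x \<in> L" if "x \<in> carrier ?FA" for x
      unfolding N_def L_def \<psi>_def using emb_closed[OF that] fst_\<phi>[OF that] that
      by (simp add: prod_eq_iff)
    have "fin_gen_submodule A ?FA L"
      using coh \<psi> unfolding left_coherent_ring_iff[OF A.ring_axioms] L_def by blast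
    then obtain X where X: "X \<subseteq> L" "finite X"
      and X_gen: "\<And>T. left_submodule A ?FA T \<Longrightarrow> X \<subseteq> T \<Longrightarrow> L \<subseteq> T"
      unfolding fin_gen_submodule_def by blast

    \<comment> \<open>Reduction modulo \<open>(B^+)^n\<close> to the noetherian ring
      \<open>K\<close>\<close>
    define pr :: "(nat \<Rightarrow> 'k \<times> 'a) \<Rightarrow> nat \<Rightarrow> 'k" where "pr p = (\<lambda>i. fst (p i))" for p
    have pr: "left_submodule K ?FK (pr ` T)" if T: "left_submodule ?B ?FB T" for T
    proof (rule left_submoduleI)
      show "pr ` T \<subseteq> carrier ?FK"
      proof (rule image_subsetI)
        fix p assume "p \<in> T"
        then have "p \<in> carrier ?FB"
          by (rule left_submodule_carrier[OF T])
        then show "pr p \<in> carrier ?FK"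
          by (simp add: pr_def carrier_free_mod_finite mem_Times_iff)
      qed
      show "\<zero>\<^bsub>?FK\<^esub> \<in> pr ` T"
        by (rule image_eqI[OF _ left_submodule_zero[OF T]]) (simp add: pr_def)
    next
      fix x y assume "x \<in> pr ` T" "y \<in> pr ` T"
      then obtain p q where pq: "x = pr p" "p \<in> T" "y = pr q" "q \<in> T" by blast
      show "x \<oplus>\<^bsub>?FK\<^esub> y \<in> pr ` T"
        by (rule image_eqI[OF _ left_submodule_add[OF T pq(2,4)]]) (simp add: pr_def pq(1,3))
    next
      fix k x assume k: "k \<in> carrier K" and "x \<in> pr ` T"
      then obtain p where p: "x = pr p" "p \<in> T" by blast
      \<comment> \<open>The scalar \<open>k\<close> of \<open>K\<close> acts on \<open>B^n\<close>
        as the element \<open>(k, 0)\<close> of \<open>B\<close>.\<close>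
      have k': "(k, \<zero>\<^bsub>A\<^esub>) \<in> carrier ?B"
        using k by simp
      show "k \<odot>\<^bsub>?FK\<^esub> x \<in> pr ` T"
        by (rule image_eqI[OF _ left_submodule_smult[OF T k' p(2)]]) (simp add: pr_def p(1))
    qed
    obtain G where G: "G \<subseteq> pr ` N" "finite G"
      and G_gen: "\<And>T. left_submodule K ?FK T \<Longrightarrow> G \<subseteq> T \<Longrightarrow> pr ` N \<subseteq> T"
      using noetherian_fin_gen_submodule[OF R.is_cring \<open>noetherian_ring K\<close> pr[OF N]]
      unfolding fin_gen_submodule_def by blast
    \<comment> \<open>\<open>H\<close> consists of lifts to \<open>N\<close> of the generators of
      its image in \<open>K^n\<close>.\<close>
    obtain H where H: "H \<subseteq> N" "finite H" "G = pr ` H"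
      using finite_subset_image[OF G(2,1)] by blast

    \<comment> \<open>These are the elements \<open>y\<^sub>i l\<^sub>j\<close>, viewed in
      \<open>B^n\<close>; they are to generate the image of \<open>L\<close> over
      \<open>B\<close>.\<close>
    define E where "E = {emb (y \<odot>\<^bsub>?FA\<^esub> l) |y l. y \<in> Y \<and> l \<in> X}"
    have "E \<subseteq> N"
    proof -
      have "emb (y \<odot>\<^bsub>?FA\<^esub> l) \<in> N" if "y \<in> Y" "l \<in> X" for y l
      proof -
        have "y \<odot>\<^bsub>?FA\<^esub> l \<in> L"
          by (rule left_submodule_smult[OF L]) (use that Y X in blast)+
        then show ?thesis
          using emb_N_iff left_submodule_carrier[OF L] by blast
      qed
      then show ?thesis
        unfolding E_def by blast
    qed
    moreover have "finite E"
      unfolding E_def using Y(2) X(2) finite_image_set2[of "\<lambda>y. y \<in> Y" "\<lambda>l. l \<in> X"] by simp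

    \<comment> \<open>Generation of \<open>N\<close> over \<open>B\<close> by \<open>H\<close> and
      \<open>E\<close>\<close>
    moreover have "N \<subseteq> T" if T: "left_submodule ?B ?FB T" and HE: "H \<union> E \<subseteq> T" for T
    proof
      have emb_T: "emb x \<in> T" if "x \<in> L" for x
      proof -
        \<comment> \<open>\<open>T\<close> is a submodule over \<open>B\<close> only, so its
          preimage under \<open>emb\<close> is not visibly closed under \<open>A\<close>. Requiring
          all \<open>A\<close>-multiples of \<open>x\<close> to land in \<open>T\<close> builds this
          closure in, and \<open>X_gen\<close> becomes applicable.\<close>
        let ?T = "{x \<in> carrier ?FA. \<forall>a \<in> carrier A. emb (a \<odot>\<^bsub>?FA\<^esub> x) \<in> T}"
        have "left_submodule A ?FA ?T"
        proof (rule left_submoduleI)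
          have "emb \<zero>\<^bsub>?FA\<^esub> \<in> T"
            using left_submodule_zero[OF T] by (simp add: emb_def)
          then show "\<zero>\<^bsub>?FA\<^esub> \<in> ?T"
            by (simp add: FA.smult_r_null del: free_mod_sel)
        next
          fix x y assume "x \<in> ?T" "y \<in> ?T"
          then show "x \<oplus>\<^bsub>?FA\<^esub> y \<in> ?T"
            by (simp add: FA.smult_r_distr emb_add left_submodule_add[OF T] del: free_mod_sel)
        next
          fix a x assume "a \<in> carrier A" "x \<in> ?T"
          then show "a \<odot>\<^bsub>?FA\<^esub> x \<in> ?T"
            by (simp add: sc flip: FA.smult_assoc1 del: free_mod_sel)
        qed blast
        moreover have "X \<subseteq> ?T"
        proof
          fix l assume l: "l \<in> X"
          then have l': "l \<in> carrier ?FA"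
            using X(1) left_submodule_carrier[OF L] by blast
          have "emb (a \<odot>\<^bsub>?FA\<^esub> l) \<in> T" if a: "a \<in> carrier A" for a
          proof -
            have "emb ((a \<otimes>\<^bsub>A\<^esub> \<one>\<^bsub>A\<^esub>) \<odot>\<^bsub>?FA\<^esub> l) \<in> T"
            \<comment> \<open>For \<open>u = b \<Delta> y\<close> the vector \<open>(a u) l\<close>
              equals \<open>(a b) \<Delta> (y l)\<close>. It is the multiple by
              \<open>(0, a b)\<close> of an element of \<open>E\<close>, hence in
              \<open>T\<close>.\<close>
            proof (rule gen[of "\<lambda>u. emb ((a \<otimes>\<^bsub>A\<^esub> u) \<odot>\<^bsub>?FA\<^esub> l) \<in> T"])
              fix b y assume b: "b \<in> carrier A" and y: "y \<in> Y"
              then have y': "y \<in> carrier A"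
                using Y by blast
              have "a \<otimes>\<^bsub>A\<^esub> (b \<otimes>\<^bsub>A\<^esub> \<Delta> \<otimes>\<^bsub>A\<^esub> y) = (a \<otimes>\<^bsub>A\<^esub> b) \<otimes>\<^bsub>A\<^esub> \<Delta> \<otimes>\<^bsub>A\<^esub> y"
                using a b y' \<Delta> by (simp add: A.m_assoc)
              moreover have "emb (y \<odot>\<^bsub>?FA\<^esub> l) \<in> T"
                using HE y l unfolding E_def by blast
              then have "(\<zero>\<^bsub>K\<^esub>, a \<otimes>\<^bsub>A\<^esub> b) \<odot>\<^bsub>?FB\<^esub> emb (y \<odot>\<^bsub>?FA\<^esub> l) \<in> T"
                using a b by (intro left_submodule_smult[OF T]) simp_all
              ultimately show "emb ((a \<otimes>\<^bsub>A\<^esub> (b \<otimes>\<^bsub>A\<^esub> \<Delta> \<otimes>\<^bsub>A\<^esub> y)) \<odot>\<^bsub>?FA\<^esub> l) \<in> T"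
                using a b y' l' by (simp add: emb_smult del: free_mod_sel)
            next
              fix v w assume "v \<in> carrier A" "w \<in> carrier A"
                "emb ((a \<otimes>\<^bsub>A\<^esub> v) \<odot>\<^bsub>?FA\<^esub> l) \<in> T" "emb ((a \<otimes>\<^bsub>A\<^esub> w) \<odot>\<^bsub>?FA\<^esub> l) \<in> T"
              then show "emb ((a \<otimes>\<^bsub>A\<^esub> (v \<oplus>\<^bsub>A\<^esub> w)) \<odot>\<^bsub>?FA\<^esub> l) \<in> T"
                using a l'
                by (simp add: A.r_distr emb_distr left_submodule_add[OF T] del: free_mod_sel)
            qed
            then show ?thesis
              using a by (simp only: A.r_one)
          qed
          then show "l \<in> ?T"
            using l' by blast
        qed
        ultimately have "L \<subseteq> ?T"
          by (rule X_gen)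
        then have "emb (\<one>\<^bsub>A\<^esub> \<odot>\<^bsub>?FA\<^esub> x) \<in> T" "x \<in> carrier ?FA"
          using that by blast+
        then show ?thesis
          by (simp only: FA.smult_one)
      qed
      fix p assume p: "p \<in> N"
      \<comment> \<open>With \<open>T \<inter> N\<close> in place of \<open>T\<close>, the element
        \<open>t\<close> of \<open>T\<close> with the same image as \<open>p\<close> in
        \<open>K^n\<close> also lies in \<open>N\<close>, and so does \<open>p - t\<close>.\<close>
      have "left_submodule ?B ?FB (T \<inter> N)"
        using T N by (simp add: left_submodule_def subset_iff)
      moreover have "G \<subseteq> pr ` (T \<inter> N)"
        using H HE by blast
      ultimately have "pr ` N \<subseteq> pr ` (T \<inter> N)"
        by (intro G_gen pr)
      then obtain t where t: "t \<in> T" "t \<in> N" "pr p = pr t"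
        using p by blast
      have mem: "p \<in> carrier ?FB" "t \<in> carrier ?FB"
        using p t(2) left_submodule_carrier[OF N] by blast+
      define d where "d = \<ominus>\<^bsub>?FB\<^esub> t \<oplus>\<^bsub>?FB\<^esub> p"
      \<comment> \<open>Writing \<open>- t\<close> as a scalar multiple lets the closure properties
        of \<open>N\<close> apply.\<close>
      have d_eq: "d = (\<ominus>\<^bsub>?B\<^esub> \<one>\<^bsub>?B\<^esub>) \<odot>\<^bsub>?FB\<^esub> t \<oplus>\<^bsub>?FB\<^esub> p"
        unfolding d_def FB.smult_minus_one[OF mem(2)] ..
      have d_N: "d \<in> N"
        unfolding d_eq by (intro left_submodule_add[OF N] left_submodule_smult[OF N] p t(2)
          B.add.inv_closed B.one_closed)
      have p_eq: "p = t \<oplus>\<^bsub>?FB\<^esub> d"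
        unfolding d_def by (rule FB.M.r_neg2[OF mem(2,1), symmetric])
      \<comment> \<open>\<open>p\<close> and \<open>t\<close> have equal
        \<open>K\<close>-components, so \<open>d\<close> lies in \<open>(B^+)^n\<close>. Being in
        \<open>N\<close> too, it comes from \<open>L\<close>, and \<open>emb_T\<close> puts it into
        \<open>T\<close>.\<close>
      have "fst (d i) = \<zero>\<^bsub>K\<^esub>" for i
      proof -
        have "fst (p i) = fst (t i) \<oplus>\<^bsub>K\<^esub> fst (d i)"
          using arg_cong[OF fun_cong[OF p_eq, of i], of fst]
          by (simp only: free_mod_sel unital_homotope_sel fst_conv)
        moreover have "fst (p i) = fst (t i)"
          using fun_cong[OF t(3), of i] by (simp only: pr_def)
        moreover have "fst (t i) \<in> carrier K" "fst (d i) \<in> carrier K"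
          using B.free_mod_carrierD[OF mem(2), of i]
            B.free_mod_carrierD[OF left_submodule_carrier[OF N d_N], of i]
          by (simp_all add: mem_Times_iff)
        ultimately show ?thesis
          using R.add.l_cancel_one'[of "fst (t i)" "fst (d i)"] by simp
      qed
      then have emb_d: "d = emb (\<lambda>i. snd (d i))"
        unfolding emb_def by (intro ext) (simp only: prod_eq_iff fst_conv snd_conv)
      have "(\<lambda>i. snd (d i)) \<in> carrier ?FA"
        using left_submodule_carrier[OF N d_N] by (simp add: carrier_free_mod_finite mem_Times_iff)
      then have "d \<in> T"
        using emb_T[of "\<lambda>i. snd (d i)"] emb_N_iff[of "\<lambda>i. snd (d i)"] d_N
        by (simp only: flip: emb_d)
      then show "p \<in> T"
        unfolding p_eq by (rule left_submodule_add[OF T t(1)])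
    qed
    ultimately have "fin_gen_submodule ?B ?FB N"
      unfolding fin_gen_submodule_def using H(1,2) by (intro exI[of _ "H \<union> E"]) simp
    then show ?thesis
      by (simp only: N_def)
  qed
  then show ?thesis
    unfolding left_coherent_ring_iff[OF B.ring_axioms] by blast
qed

end

theorem theorem49:
  fixes K :: "'k ring" and A :: "('k, 'a) module" and \<Delta> :: 'a
  assumes "cring K" and "noetherian_ring K"
    and "unital_algebra K A" and "free_module K A"
    and "\<Delta> \<in> carrier A" and "well_tempered K A \<Delta>"
    and "left_coherent_ring A"
  shows "left_coherent_ring (unital_homotope K A \<Delta>)"
proof -
  interpret algebra_homotope K A \<Delta>
    using assms by (intro algebra_homotope.intro algebra_homotope_axioms.intro)
  show ?thesis
    using assms left_coherent_unital_homotope unfolding well_tempered_def by blast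
qed

end
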